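(* Let $m\geq 3$ be even and let $k\geq 1$ be an integer with $k\leq m-1$. Let $H^*$ be the graph with vertex set $W_1\cup\dots\cup W_{k-1}\cup\{v_1,\dots,v_k\}$, where the $W_i$ are pairwise disjoint sets with $|W_i|=m-2$, constructed as follows: for $i=1,\dots,k-1$ let $H'_i$ be the graph on $W_i\cup\{v_i\}$ in which $W_i$ induces a complete graph $K_{m-2}$ and $v_i$ is adjacent to exactly $m-3$ vertices of $W_i$ (all except one vertex $w_i\in W_i$); let $H'_k$ be the single vertex $v_k$; and let $H^*=H'_1\oplus H'_2\oplus\dots\oplus H'_k$ be the join of these graphs. (Thus $|V(H^* )|=(k-1)(m-1)+1$ and $H^*$ is the complete graph on these vertices minus the $k-1$ edges $v_iw_i$.) Let $\mathcal{F}$ be the family of connected graphs on $m$ vertices that are subgraphs of the graph obtained from $K_m$ by deleting the edges of a perfect matching ($\frac{m}{2}K_2$). Then for every $G\in\mathcal{F}$, $H^*$ is $k$-$G$-free-vertex-minimal.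
   Context: All graphs are finite, simple and undirected. The join $A\oplus B$ of graphs $A,B$ is obtained from their disjoint union by joining every vertex of $A$ to every vertex of $B$. For a graph $G$ on at least 2 vertices, a $G$-free $k$-colouring of a graph $H$ is a map $\pi:V(H)\to\{1,\dots,k\}$ such that for every $i$ the subgraph of $H$ induced by $\pi^{-1}(i)$ contains no subgraph isomorphic to $G$. The $G$-free chromatic number $\chi_G(H)$ is the least $k$ for which a $G$-free $k$-colouring of $H$ exists. $H$ is $G$-free-vertex-minimal if $\chi_G(H\setminus\{v\})\leq\chi_G(H)-1$ for every vertex $v$; $H$ is $k$-$G$-free-vertex-minimal if moreover $\chi_G(H)=k$. *)

theory Defs
  imports
    "Graph_Theory.Graph_Theory"
    "HOL-Library.FuncSet"
    "HOL-Library.Disjoint_Sets"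
begin

text \<open>
  Finite simple undirected graphs are the symmetric loop-free digraphs without parallel arcs of
  the library (locales \<open>graph\<close> and \<open>pair_graph\<close>): an undirected edge \<open>uv\<close> is the pair of arcs
  \<open>(u, v)\<close> and \<open>(v, u)\<close>.
\<close>

definition contains_copy :: "('c, 'd) pre_digraph \<Rightarrow> ('a, 'b) pre_digraph \<Rightarrow> bool" where
  "contains_copy G H \<longleftrightarrow> (\<exists>S. subgraph S H \<and> digraph_iso G S)"

definition free_colouring ::
    "('c, 'd) pre_digraph \<Rightarrow> ('a, 'b) pre_digraph \<Rightarrow> nat \<Rightarrow> ('a \<Rightarrow> nat) \<Rightarrow> bool" where
  "free_colouring G H k \<pi> \<longleftrightarrow>
     \<pi> \<in> verts H \<rightarrow> {1..k} \<and>
     (\<forall>i\<in>{1..k}. \<not> contains_copy G (H \<restriction> {x \<in> verts H. \<pi> x = i}))"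

text \<open>
  If \<open>G\<close> has at least two vertices and \<open>H\<close> is finite, an injective colouring is \<open>G\<close>-free, so the
  minimum below is over a nonempty set.  The graph without vertices has chromatic number \<open>0\<close>.
\<close>

definition free_chromatic_number ::
    "('c, 'd) pre_digraph \<Rightarrow> ('a, 'b) pre_digraph \<Rightarrow> nat" where
  "free_chromatic_number G H = (LEAST k. \<exists>\<pi>. free_colouring G H k \<pi>)"

definition free_vertex_minimal :: "('c, 'd) pre_digraph \<Rightarrow> ('a, 'b) pre_digraph \<Rightarrow> bool" where
  "free_vertex_minimal G H \<longleftrightarrow>
     (\<forall>x\<in>verts H. int (free_chromatic_number G (pre_digraph.del_vert H x))
                  \<le> int (free_chromatic_number G H) - 1)"

definition k_free_vertex_minimal ::
    "nat \<Rightarrow> ('c, 'd) pre_digraph \<Rightarrow> ('a, 'b) pre_digraph \<Rightarrow> bool" where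
  "k_free_vertex_minimal k G H \<longleftrightarrow> free_vertex_minimal G H \<and> free_chromatic_number G H = k"

text \<open>
  This is the join only when the two vertex sets are disjoint, so that their union is the
  disjoint union.
\<close>

definition graph_join ::
    "'a pair_pre_digraph \<Rightarrow> 'a pair_pre_digraph \<Rightarrow> 'a pair_pre_digraph" (infixr \<open>\<oplus>\<^sub>G\<close> 65) where
  "A \<oplus>\<^sub>G B =
     \<lparr> pverts = pverts A \<union> pverts B,
       parcs = parcs A \<union> parcs B \<union> pverts A \<times> pverts B \<union> pverts B \<times> pverts A \<rparr>"

text \<open>The join of a list of graphs; the graph without vertices is neutral for the join.\<close>

definition graph_join_list :: "'a pair_pre_digraph list \<Rightarrow> 'a pair_pre_digraph" where
  "graph_join_list Hs = foldr (\<oplus>\<^sub>G) Hs \<lparr> pverts = {}, parcs = {} \<rparr>"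

definition single_vertex_graph :: "'a \<Rightarrow> 'a pair_pre_digraph" where
  "single_vertex_graph x = \<lparr> pverts = {x}, parcs = {} \<rparr>"

text \<open>
  The complete graph on \<open>W\<close> together with a further vertex \<open>x\<close> adjacent to all vertices of \<open>W\<close>
  except \<open>w\<close>.
\<close>

definition clique_plus_vertex :: "'a set \<Rightarrow> 'a \<Rightarrow> 'a \<Rightarrow> 'a pair_pre_digraph" where
  "clique_plus_vertex W x w =
     \<lparr> pverts = insert x W,
       parcs = {(y, z). y \<in> W \<and> z \<in> W \<and> y \<noteq> z} \<union> {x} \<times> (W - {w}) \<union> (W - {w}) \<times> {x} \<rparr>"

definition H_part ::
    "nat \<Rightarrow> (nat \<Rightarrow> 'a set) \<Rightarrow> (nat \<Rightarrow> 'a) \<Rightarrow> (nat \<Rightarrow> 'a) \<Rightarrow> nat \<Rightarrow> 'a pair_pre_digraph" where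
  "H_part k W v w i =
     (if i < k then clique_plus_vertex (W i) (v i) (w i) else single_vertex_graph (v i))"

definition H_star ::
    "nat \<Rightarrow> (nat \<Rightarrow> 'a set) \<Rightarrow> (nat \<Rightarrow> 'a) \<Rightarrow> (nat \<Rightarrow> 'a) \<Rightarrow> 'a pair_pre_digraph" where
  "H_star k W v w = graph_join_list (map (H_part k W v w) [1..<k + 1])"

definition perfect_matching :: "'a pair_pre_digraph \<Rightarrow> 'a rel \<Rightarrow> bool" where
  "perfect_matching K M \<longleftrightarrow>
     M \<subseteq> parcs K \<and> sym M \<and> (\<forall>x\<in>pverts K. \<exists>!y. (x, y) \<in> M)"

definition delete_edges :: "'a pair_pre_digraph \<Rightarrow> 'a rel \<Rightarrow> 'a pair_pre_digraph" where
  "delete_edges K M = \<lparr> pverts = pverts K, parcs = parcs K - M \<rparr>"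

text \<open>
  \<open>K\<close> is an arbitrary complete graph on \<open>m\<close> vertices and \<open>M\<close> an arbitrary perfect matching of it;
  hence the family is closed under isomorphism.
\<close>

definition connected_sub_cocktail_party :: "nat \<Rightarrow> 'a pair_pre_digraph set" where
  "connected_sub_cocktail_party m =
     {G. pair_graph G \<and> connected (with_proj G) \<and> card (pverts G) = m \<and>
         (\<exists>K M. complete_digraph m (with_proj K) \<and> perfect_matching K M \<and>
                subgraph (with_proj G) (with_proj (delete_edges K M)))}"

end

theory Submission
  imports Defs
begin

text \<open>
  The non-edges of \<open>H\<^sup>*\<close> form a matching. A graph on an even number \<open>m\<close> of vertices whose non-edges
  form a matching contains the complement of a perfect matching, hence every \<open>G\<close> of the family,
  so a \<open>G\<close>-free colour class has at most \<open>m - 1\<close> vertices. Conversely, fewer than \<open>m\<close> vertices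
  never contain \<open>G\<close>. Hence \<open>j\<close> colours suffice for \<open>H\<^sup>*\<close> or for \<open>H\<^sup>*\<close> without a vertex if and
  only if the graph has at most \<open>j (m - 1)\<close> vertices, while \<open>H\<^sup>*\<close> has \<open>(k - 1) (m - 1) + 1\<close>.
\<close>

section \<open>Bijections that pull one matching back into another\<close>

text \<open>\<open>M\<close> acts as a perfect matching on \<open>V\<close>, and \<open>N\<close> as
  an arbitrary matching on \<open>A\<close>. Induction strips an \<open>M\<close>-edge from
  \<open>V\<close> and two vertices from \<open>A\<close> that no \<open>N\<close>-pair joins to the
  rest. \<open>M\<close> and \<open>N\<close> stay fixed; only the partner condition is relative to
  the current \<open>V\<close>.\<close>

lemma bij_betw_complement_matching:
  assumes "finite V" "finite A" "card A = card V"
    and "sym M" "single_valued M" "\<And>x. x \<in> V \<Longrightarrow> \<exists>y\<in>V - {x}. (x, y) \<in> M"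
    and "sym N" "single_valued N"
  shows "\<exists>f. bij_betw f V A \<and> (\<forall>x\<in>V. \<forall>y\<in>V. (f x, f y) \<in> N \<longrightarrow> x = y \<or> (x, y) \<in> M)"
  using assms(1-3) assms(6)
proof (induction "card V" arbitrary: V A rule: less_induct)
  case less
  show ?case
  proof (cases "V = {}")
    case True
    with less.prems have "A = {}" by simp
    with True show ?thesis by (simp add: bij_betw_def)
  next
    case False
    then obtain x where x: "x \<in> V" by blast
    with less.prems(4) obtain y where y: "y \<in> V" "y \<noteq> x" "(x, y) \<in> M" by blast
    have yx: "(y, x) \<in> M" using y(3) \<open>sym M\<close> by (auto dest: symD)
    have "card {x, y} \<le> card V"
      using x y less.prems(1) by (intro card_mono) auto
    with y have "2 \<le> card A" using less.prems(3) by simp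
    \<comment> \<open>If \<open>A\<close> has an \<open>N\<close>-edge, its ends are taken: being
      matched to each other, they are matched to nothing else. Otherwise any two vertices will
      do.\<close>
    obtain a b where ab: "a \<in> A" "b \<in> A" "a \<noteq> b"
      and sep: "\<And>c. c \<in> A - {a, b} \<Longrightarrow> (a, c) \<notin> N \<and> (c, a) \<notin> N \<and> (b, c) \<notin> N \<and> (c, b) \<notin> N"
    proof (cases "\<exists>a\<in>A. \<exists>b\<in>A. a \<noteq> b \<and> (a, b) \<in> N")
      case True
      then obtain a b where *: "a \<in> A" "b \<in> A" "a \<noteq> b" "(a, b) \<in> N" by blast
      with \<open>sym N\<close> have **: "(b, a) \<in> N" by (auto dest: symD)
      have "(a, c) \<notin> N \<and> (c, a) \<notin> N \<and> (b, c) \<notin> N \<and> (c, b) \<notin> N" if "c \<in> A - {a, b}" for c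
        using that *(4) ** symD[OF \<open>sym N\<close>] single_valuedD[OF \<open>single_valued N\<close>] by blast
      then show thesis by (rule that[OF *(1-3)])
    next
      case False
      obtain B where "B \<subseteq> A" "card B = 2"
        using \<open>2 \<le> card A\<close> by (rule obtain_subset_with_card_n)
      then obtain a b where "a \<in> A" "b \<in> A" "a \<noteq> b"
        by (auto simp: card_2_iff)
      moreover have "(u, z) \<notin> N" if "u \<in> A" "z \<in> A" "u \<noteq> z" for u z
        using False that by blast
      ultimately show thesis by (intro that[of a b]) auto
    qed
    let ?V = "V - {x, y}" and ?A = "A - {a, b}"
    have "\<exists>f. bij_betw f ?V ?A \<and> (\<forall>u\<in>?V. \<forall>z\<in>?V. (f u, f z) \<in> N \<longrightarrow> u = z \<or> (u, z) \<in> M)"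
    proof (rule less.hyps)
      show "card ?V < card V"
        using x less.prems(1) by (intro psubset_card_mono) auto
      show "finite ?V" "finite ?A" using less.prems by auto
      show "card ?A = card ?V"
        using less.prems(2,3) x y ab by (simp add: card_Diff_subset)
    next
      fix z assume z: "z \<in> ?V"
      with less.prems(4) obtain z' where z': "z' \<in> V - {z}" "(z, z') \<in> M" by blast
      then have "(z', z) \<in> M" using \<open>sym M\<close> by (auto dest: symD)
      \<comment> \<open>A partner \<open>x\<close> or \<open>y\<close> would force \<open>z\<close>
        to be \<open>y\<close> or \<open>x\<close>, so the partner survives the removal.\<close>
      then have "z' \<noteq> x" "z' \<noteq> y"
        using z y(3) yx single_valuedD[OF \<open>single_valued M\<close>] by blast+
      with z' show "\<exists>z'\<in>?V - {z}. (z, z') \<in> M" by blast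
    qed
    then obtain f where f: "bij_betw f ?V ?A"
      "\<And>u z. u \<in> ?V \<Longrightarrow> z \<in> ?V \<Longrightarrow> (f u, f z) \<in> N \<Longrightarrow> u = z \<or> (u, z) \<in> M" by blast
    define g where "g = f(x := a, y := b)"
    have gf: "g u = f u" if "u \<in> ?V" for u using that by (auto simp: g_def)
    have gx: "g x = a" "g y = b" using y by (auto simp: g_def)
    have fA: "f u \<in> ?A" if "u \<in> ?V" for u using f(1) that by (auto simp: bij_betw_def)
    have "bij_betw g ?V ?A" using f(1) gf bij_betw_cong[of ?V g f ?A] by blast
    moreover have "bij_betw g {x, y} {a, b}"
      using gx ab by (auto simp: bij_betw_def inj_on_def)
    ultimately have "bij_betw g (?V \<union> {x, y}) (?A \<union> {a, b})"
      by (intro bij_betw_combine) auto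
    moreover have V_eq: "?V \<union> {x, y} = V" and A_eq: "?A \<union> {a, b} = A" using x y ab by auto
    ultimately have "bij_betw g V A" by (simp only: V_eq A_eq)
    \<comment> \<open>Pairs inside \<open>?V\<close> are settled by induction, \<open>sep\<close>
      excludes mixed pairs, and the remaining pair \<open>{x, y}\<close> is itself an
      \<open>M\<close>-edge.\<close>
    moreover have "u = z \<or> (u, z) \<in> M" if "u \<in> V" "z \<in> V" "(g u, g z) \<in> N" for u z
    proof -
      consider "u \<in> ?V" "z \<in> ?V" | "u \<in> ?V" "z \<in> {x, y}" | "u \<in> {x, y}" "z \<in> ?V"
        | "u \<in> {x, y}" "z \<in> {x, y}" using \<open>u \<in> V\<close> \<open>z \<in> V\<close> by blast
      then show ?thesis
      proof cases
        case 1
        then show ?thesis using f(2) that(3) gf by auto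
      next
        case 2
        then show ?thesis using sep[OF fA[OF 2(1)]] that(3) gf[OF 2(1)] gx by auto
      next
        case 3
        then show ?thesis using sep[OF fA[OF 3(2)]] that(3) gf[OF 3(2)] gx by auto
      next
        case 4
        then show ?thesis using y yx by auto
      qed
    qed
    ultimately show ?thesis by blast
  qed
qed

section \<open>Copies of a graph in an induced subgraph\<close>

text \<open>The required subgraph is the image of \<open>G\<close> under \<open>f\<close>. Arcs are
  pairs of vertices, so the vertex map alone determines the arc map, \<open>map_prod f f\<close>,
  which inherits injectivity from \<open>f\<close>.\<close>

lemma contains_copyI_pair:
  assumes "pair_wf_digraph G" "wf_digraph H" "tail H = fst" "head H = snd"
    and inj: "inj_on f (pverts G)" and "f ` pverts G \<subseteq> verts H"
    and arcs: "\<And>x y. (x, y) \<in> parcs G \<Longrightarrow> (f x, f y) \<in> arcs H"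
  shows "contains_copy (with_proj G) H"
proof -
  interpret G: pair_wf_digraph G by fact
  define h where
    "h = \<lparr> iso_verts = f, iso_arcs = map_prod f f, iso_head = snd, iso_tail = fst \<rparr>"
  have sub: "parcs G \<subseteq> pverts G \<times> pverts G"
    by (auto dest: G.in_arcsD1 G.in_arcsD2)
  have iso: "pre_digraph.digraph_isomorphism (with_proj G) h"
    unfolding pre_digraph.digraph_isomorphism_def
  proof (intro conjI)
    show "inj_on (iso_arcs h) (arcs (with_proj G))"
      using inj_on_subset[OF map_prod_inj_on[OF inj inj] sub] by (simp add: h_def)
  qed (use inj G.wf_digraph in \<open>auto simp: h_def\<close>)
  have "wf_digraph (app_iso h (with_proj G))"
    using G.wf_digraphI_app_iso iso by blast
  then have "subgraph (app_iso h (with_proj G)) H"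
    using assms by (auto simp: subgraph_def compatible_def h_def)
  with iso show ?thesis
    unfolding contains_copy_def digraph_iso_def by blast
qed

lemma contains_copy_card_le:
  assumes "contains_copy G H" "finite (verts H)"
  shows "card (verts G) \<le> card (verts H)"
proof -
  from assms obtain f where f: "pre_digraph.digraph_isomorphism G f"
    "subgraph (app_iso f G) H"
    unfolding contains_copy_def digraph_iso_def by blast
  then have "inj_on (iso_verts f) (verts G)" "iso_verts f ` verts G \<subseteq> verts H"
    by (auto simp: pre_digraph.digraph_isomorphism_def subgraph_def)
  with assms(2) show ?thesis by (simp add: card_inj_on_le)
qed

text \<open>\<open>N\<close> covers all non-edges inside \<open>A\<close>. A bijection from the
  vertices of \<open>K\<close> onto \<open>m\<close> vertices of \<open>A\<close> pulls
  \<open>N\<close> back into \<open>M\<close>. Edges of \<open>G\<close> avoid \<open>M\<close>, so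
  their images avoid \<open>N\<close> and are edges of \<open>H\<close>.\<close>

lemma contains_copy_induced_matching_complement:
  fixes H :: "'a pair_pre_digraph" and G :: "'b pair_pre_digraph"
  assumes G: "G \<in> connected_sub_cocktail_party m"
    and H: "pair_wf_digraph H" and N: "sym N" "single_valued N"
    and A: "finite A" "m \<le> card A" "A \<subseteq> pverts H"
    and adj: "\<And>x y. x \<in> A \<Longrightarrow> y \<in> A \<Longrightarrow> x \<noteq> y \<Longrightarrow> (x, y) \<notin> N \<Longrightarrow> (x, y) \<in> parcs H"
  shows "contains_copy (with_proj G) (with_proj H \<restriction> A)"
proof -
  from G obtain K M where gG: "pair_graph G" and m: "card (pverts G) = m"
    and K: "complete_digraph m (with_proj K)" and M: "perfect_matching K M"
    and sub: "subgraph (with_proj G) (with_proj (delete_edges K M))"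
    unfolding connected_sub_cocktail_party_def by blast
  have K': "finite (pverts K)" "card (pverts K) = m"
    "parcs K = {(u, v). (u, v) \<in> pverts K \<times> pverts K \<and> u \<noteq> v}"
    using K unfolding complete_digraph_pair_def by auto
  \<comment> \<open>\<open>G\<close> is a spanning subgraph, since both vertex sets have
    \<open>m\<close> elements.\<close>
  have V: "pverts G = pverts K"
    using sub K' m by (intro card_subset_eq) (auto simp: subgraph_def delete_edges_def)
  have parcs_G: "parcs G \<subseteq> parcs K - M"
    using sub by (auto simp: subgraph_def delete_edges_def)
  have M': "M \<subseteq> parcs K" "sym M" "\<And>x. x \<in> pverts K \<Longrightarrow> \<exists>!y. (x, y) \<in> M"
    using M unfolding perfect_matching_def by auto
  have sv: "single_valued M"
    using M' K'(3) unfolding single_valued_def by blast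
  have partner: "\<exists>y\<in>pverts K - {x}. (x, y) \<in> M" if "x \<in> pverts K" for x
    using M'(1) M'(3)[OF that] K'(3) by blast
  obtain B where B: "B \<subseteq> A" "card B = m" "finite B"
    using A(2) by (rule obtain_subset_with_card_n)
  have "card B = card (pverts K)" using B K' by simp
  from bij_betw_complement_matching[OF K'(1) B(3) this M'(2) sv partner N]
  obtain f where f: "bij_betw f (pverts K) B"
    "\<And>x y. x \<in> pverts K \<Longrightarrow> y \<in> pverts K \<Longrightarrow> (f x, f y) \<in> N \<Longrightarrow> x = y \<or> (x, y) \<in> M"
    by blast
  interpret H: pair_wf_digraph H by fact
  interpret G: pair_graph G by fact
  show ?thesis
  proof (rule contains_copyI_pair)
    show "pair_wf_digraph G" by unfold_locales
    show "wf_digraph (with_proj H \<restriction> A)" by unfold_locales (auto simp: induce_subgraph_def)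
    show "inj_on f (pverts G)" using f(1) V by (auto simp: bij_betw_def)
    show "f ` pverts G \<subseteq> verts (with_proj H \<restriction> A)" using f(1) V B by (auto simp: bij_betw_def)
  next
    fix x y assume xy: "(x, y) \<in> parcs G"
    then have xy': "x \<in> pverts K" "y \<in> pverts K" "x \<noteq> y" "(x, y) \<notin> M"
      using parcs_G K'(3) by auto
    then have "f x \<in> A" "f y \<in> A" "f x \<noteq> f y" "(f x, f y) \<notin> N"
      using f B by (auto simp: bij_betw_def inj_on_def)
    then show "(f x, f y) \<in> arcs (with_proj H \<restriction> A)"
      using adj by (auto simp: induce_subgraph_def)
  qed (simp_all add: induce_subgraph_def)
qed

section \<open>Bounds between numbers of colours and numbers of vertices\<close>

text \<open>Number the vertices and cut the numbering into \<open>j\<close> consecutive blocks of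
  length one less than the order of \<open>G\<close>. Every colour class is then too small for a
  copy of \<open>G\<close>.\<close>

lemma ex_free_colouring:
  assumes "finite (verts H)" and "card (verts H) \<le> j * (card (verts G) - 1)"
    and "card (verts G) > 0"
  shows "\<exists>\<pi>. free_colouring G H j \<pi>"
proof -
  define d where "d = card (verts G) - 1"
  obtain h where h: "bij_betw h (verts H) {0..<card (verts H)}"
    using ex_bij_betw_finite_nat[OF assms(1)] by blast
  have lt: "h x < j * d" if "x \<in> verts H" for x
  proof -
    have "h x \<in> {0..<card (verts H)}" using h that by (rule bij_betwE[rule_format])
    with assms(2) show ?thesis by (simp add: d_def)
  qed
  \<comment> \<open>The successor shifts block indices, which start at 0, to colours, which start at
    1.\<close>
  define \<pi> where "\<pi> x = Suc (h x div d)" for x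
  have "free_colouring G H j \<pi>"
    unfolding free_colouring_def
  proof (intro conjI ballI)
    show "\<pi> \<in> verts H \<rightarrow> {1..j}"
      using lt by (auto simp: \<pi>_def Suc_le_eq less_mult_imp_div_less)
  next
    fix i assume i: "i \<in> {1..j}"
    let ?C = "{x \<in> verts H. \<pi> x = i}"
    have "h ` ?C \<subseteq> {(i - 1) * d..<(i - 1) * d + d}"
    proof
      fix n assume "n \<in> h ` ?C"
      then obtain x where x: "x \<in> verts H" "\<pi> x = i" "n = h x" by blast
      \<comment> \<open>The bound \<open>h x < j * d\<close> excludes \<open>d = 0\<close>: in that
        case \<open>H\<close> has no vertices.\<close>
      then have "n div d = i - 1" "d > 0"
        using lt[OF x(1)] by (auto simp: \<pi>_def intro: Nat.gr0I)
      then have "n = (i - 1) * d + n mod d" "n mod d < d"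
        using div_mult_mod_eq[of n d] by simp_all
      then show "n \<in> {(i - 1) * d..<(i - 1) * d + d}"
        unfolding atLeastLessThan_iff by linarith
    qed
    moreover have "inj_on h ?C"
      using h by (auto simp: bij_betw_def inj_on_def)
    ultimately have "card ?C \<le> card {(i - 1) * d..<(i - 1) * d + d}"
      by (intro card_inj_on_le) auto
    then have "card ?C < card (verts G)"
      using assms(3) by (simp add: d_def)
    moreover have "verts (H \<restriction> ?C) = ?C" "finite ?C"
      using assms(1) by (simp_all add: induce_subgraph_def)
    ultimately show "\<not> contains_copy G (H \<restriction> ?C)"
      using contains_copy_card_le[of G "H \<restriction> ?C"] by auto
  qed
  then show ?thesis by blast
qed

lemma free_chromatic_number_le:
  assumes "free_colouring G H j \<pi>"
  shows "free_chromatic_number G H \<le> j"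
  unfolding free_chromatic_number_def using assms by (intro Least_le) blast

lemma free_chromatic_number_attained:
  assumes "free_colouring G H j \<pi>"
  obtains \<pi>' where "free_colouring G H (free_chromatic_number G H) \<pi>'"
  using LeastI_ex[of "\<lambda>j. \<exists>\<pi>. free_colouring G H j \<pi>"] assms that
  unfolding free_chromatic_number_def by blast

text \<open>The \<open>j\<close> colour classes cover \<open>H\<close>, and a class with
  \<open>m\<close> or more vertices would contain \<open>G\<close>.\<close>

lemma card_le_free_colouring:
  assumes "free_colouring G H j \<pi>"
    and large: "\<And>A. A \<subseteq> verts H \<Longrightarrow> m \<le> card A \<Longrightarrow> contains_copy G (H \<restriction> A)"
  shows "card (verts H) \<le> j * (m - 1)"
proof -
  let ?C = "\<lambda>i. {x \<in> verts H. \<pi> x = i}"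
  have "verts H = (\<Union>i\<in>{1..j}. ?C i)"
    using assms(1) by (auto simp: free_colouring_def)
  then have "card (verts H) = card (\<Union>i\<in>{1..j}. ?C i)" by (rule arg_cong)
  also have "\<dots> \<le> (\<Sum>i\<in>{1..j}. card (?C i))"
    by (rule card_UN_le) simp
  also have "\<dots> \<le> (\<Sum>i\<in>{1..j}. m - 1)"
  proof (rule sum_mono)
    fix i assume "i \<in> {1..j}"
    with assms(1) have "\<not> contains_copy G (H \<restriction> ?C i)"
      unfolding free_colouring_def by blast
    with large[of "?C i"] have "\<not> m \<le> card (?C i)" by blast
    then show "card (?C i) \<le> m - 1" by simp
  qed
  finally show ?thesis by simp
qed

section \<open>Vertices, arcs and non-edges of \<open>H_star\<close>\<close>

lemma pverts_graph_join_list: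
  "pverts (graph_join_list (map f xs)) = (\<Union>i\<in>set xs. pverts (f i))"
  by (induction xs) (auto simp: graph_join_list_def graph_join_def)

text \<open>Distinctness matters because a repeated index would join a part to itself, and the union
  over \<open>j\<close> different from \<open>i\<close> omits those arcs.\<close>

lemma parcs_graph_join_list:
  assumes "distinct xs"
  shows "parcs (graph_join_list (map f xs)) =
    (\<Union>i\<in>set xs. parcs (f i)) \<union> (\<Union>i\<in>set xs. \<Union>j\<in>set xs - {i}. pverts (f i) \<times> pverts (f j))"
  using assms
proof (induction xs)
  case Nil
  then show ?case by (simp add: graph_join_list_def)
next
  case (Cons x xs)
  have "graph_join_list (map f (x # xs)) = f x \<oplus>\<^sub>G graph_join_list (map f xs)"
    by (simp add: graph_join_list_def)
  moreover have "(\<Union>i\<in>set (x # xs). \<Union>j\<in>set (x # xs) - {i}. pverts (f i) \<times> pverts (f j)) =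
      (\<Union>i\<in>set xs. \<Union>j\<in>set xs - {i}. pverts (f i) \<times> pverts (f j)) \<union>
      pverts (f x) \<times> (\<Union>i\<in>set xs. pverts (f i)) \<union> (\<Union>i\<in>set xs. pverts (f i)) \<times> pverts (f x)"
    using Cons.prems by auto
  ultimately show ?case
    using Cons by (auto simp: graph_join_def pverts_graph_join_list)
qed

lemma pverts_H_star: "pverts (H_star k W v w) = (\<Union>i\<in>{1..k}. pverts (H_part k W v w i))"
  by (simp add: H_star_def pverts_graph_join_list atLeastLessThanSuc_atLeastAtMost del: upt_Suc)

lemma parcs_H_star: "parcs (H_star k W v w) = (\<Union>i\<in>{1..k}. parcs (H_part k W v w i)) \<union>
    (\<Union>i\<in>{1..k}. \<Union>j\<in>{1..k} - {i}. pverts (H_part k W v w i) \<times> pverts (H_part k W v w j))"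
proof -
  have "set [1..<k + 1] = {1..k}" by auto
  then show ?thesis
    unfolding H_star_def by (simp only: parcs_graph_join_list[OF distinct_upt])
qed

lemma parcs_H_part_subset:
  "parcs (H_part k W v w i) \<subseteq> pverts (H_part k W v w i) \<times> pverts (H_part k W v w i)"
  by (auto simp: H_part_def clique_plus_vertex_def single_vertex_graph_def)

lemma pair_wf_digraph_H_star: "pair_wf_digraph (H_star k W v w)"
proof -
  have "parcs (H_star k W v w) \<subseteq> pverts (H_star k W v w) \<times> pverts (H_star k W v w)"
    unfolding pverts_H_star parcs_H_star
    using parcs_H_part_subset[of k W v w] by blast
  then show ?thesis by unfold_locales auto
qed

lemma card_pverts_H_star:
  assumes "m \<ge> 3" "k \<ge> 1"
    and disj: "disjoint_family_on W {1..k - 1}"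
    and W: "\<And>i. i \<in> {1..k - 1} \<Longrightarrow> finite (W i) \<and> card (W i) = m - 2"
    and v: "inj_on v {1..k}"
    and vW: "\<And>i j. i \<in> {1..k} \<Longrightarrow> j \<in> {1..k - 1} \<Longrightarrow> v i \<notin> W j"
  shows "finite (pverts (H_star k W v w))"
    and "card (pverts (H_star k W v w)) = (k - 1) * (m - 1) + 1"
proof -
  let ?P = "\<lambda>i. pverts (H_part k W v w i)"
  have P: "?P i = (if i < k then insert (v i) (W i) else {v i})" for i
    by (simp add: H_part_def clique_plus_vertex_def single_vertex_graph_def)
  have fin: "finite (?P i)" if "i \<in> {1..k}" for i
    using that W[of i] by (auto simp: P)
  then show "finite (pverts (H_star k W v w))" by (simp add: pverts_H_star)
  have "?P i \<inter> ?P j = {}" if "i \<in> {1..k}" "j \<in> {1..k}" "i \<noteq> j" for i j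
  proof -
    have "v i \<noteq> v j" using v that by (auto dest: inj_onD)
    moreover have "W i \<inter> W j = {}" if "i < k" "j < k"
      using disj that \<open>i \<in> {1..k}\<close> \<open>j \<in> {1..k}\<close> \<open>i \<noteq> j\<close> by (auto simp: disjoint_family_on_def)
    moreover have "v i \<notin> W j" if "j < k" using vW[of i j] that \<open>i \<in> {1..k}\<close> \<open>j \<in> {1..k}\<close> by auto
    moreover have "v j \<notin> W i" if "i < k" using vW[of j i] that \<open>i \<in> {1..k}\<close> \<open>j \<in> {1..k}\<close> by auto
    ultimately show ?thesis by (auto simp: P)
  qed
  then have "card (pverts (H_star k W v w)) = (\<Sum>i\<in>{1..k}. card (?P i))"
    unfolding pverts_H_star using fin by (intro card_UN_disjoint) auto
  \<comment> \<open>Part \<open>k\<close> is the single vertex that contributes the final 1. Each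
    other part is \<open>W i\<close> with \<open>v i\<close> added, hence has \<open>m - 1\<close>
    vertices.\<close>
  also have "{1..k} = insert k {1..k - 1}" using \<open>k \<ge> 1\<close> by auto
  also have "(\<Sum>i\<in>insert k {1..k - 1}. card (?P i)) = card (?P k) + (\<Sum>i\<in>{1..k - 1}. card (?P i))"
    using \<open>k \<ge> 1\<close> by (intro sum.insert) auto
  also have "(\<Sum>i\<in>{1..k - 1}. card (?P i)) = (\<Sum>i\<in>{1..k - 1}. m - 1)"
  proof (rule sum.cong[OF refl])
    fix i assume i: "i \<in> {1..k - 1}"
    with \<open>k \<ge> 1\<close> have "i \<in> {1..k}" "i < k" by auto
    then have "v i \<notin> W i" using i by (intro vW)
    then show "card (?P i) = m - 1" using W[OF i] \<open>m \<ge> 3\<close> \<open>i < k\<close> by (simp add: P)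
  qed
  finally show "card (pverts (H_star k W v w)) = (k - 1) * (m - 1) + 1"
    by (simp add: P)
qed

text \<open>The matching used as \<open>N\<close> above. The index stops at \<open>k - 1\<close>
  because part \<open>k\<close> is a single vertex.\<close>

definition H_star_nonedges :: "nat \<Rightarrow> (nat \<Rightarrow> 'a) \<Rightarrow> (nat \<Rightarrow> 'a) \<Rightarrow> 'a rel" where
  "H_star_nonedges k v w = (\<Union>i\<in>{1..k - 1}. {(v i, w i), (w i, v i)})"

lemma sym_H_star_nonedges: "sym (H_star_nonedges k v w)"
  by (auto simp: H_star_nonedges_def sym_def)

text \<open>The \<open>v i\<close> are distinct, the \<open>w i\<close> are distinct because the
  \<open>W i\<close> are disjoint, and no \<open>v i\<close> is a \<open>w j\<close>. So an endpoint
  determines its index and its role, and with them its partner.\<close>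

lemma single_valued_H_star_nonedges:
  assumes disj: "disjoint_family_on W {1..k - 1}"
    and v: "inj_on v {1..k}"
    and vW: "\<And>i j. i \<in> {1..k} \<Longrightarrow> j \<in> {1..k - 1} \<Longrightarrow> v i \<notin> W j"
    and w: "\<And>i. i \<in> {1..k - 1} \<Longrightarrow> w i \<in> W i"
  shows "single_valued (H_star_nonedges k v w)"
proof -
  have v_eq: "i = j" if "v i = v j" "i \<in> {1..k - 1}" "j \<in> {1..k - 1}" for i j
    using v that by (auto dest: inj_onD)
  have w_eq: "i = j" if "w i = w j" "i \<in> {1..k - 1}" "j \<in> {1..k - 1}" for i j
    using disj that w[of i] w[of j] unfolding disjoint_family_on_def by (metis IntI empty_iff)
  have vw: "v i \<noteq> w j" if "i \<in> {1..k - 1}" "j \<in> {1..k - 1}" for i j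
    using that vW[of i j] w[of j] by force
  have cases: "\<exists>i\<in>{1..k - 1}. x = v i \<and> y = w i \<or> x = w i \<and> y = v i"
    if "(x, y) \<in> H_star_nonedges k v w" for x y
    using that by (auto simp: H_star_nonedges_def)
  show ?thesis
  proof (rule single_valuedI)
    fix x y z
    assume "(x, y) \<in> H_star_nonedges k v w" "(x, z) \<in> H_star_nonedges k v w"
    then show "y = z" using cases v_eq w_eq vw by metis
  qed
qed

text \<open>Different parts are completely joined, and inside a part with index below
  \<open>k\<close> the only distinct non-adjacent vertices are \<open>v i\<close> and
  \<open>w i\<close>.\<close>

lemma H_star_adjacent:
  assumes "x \<in> pverts (H_star k W v w)" "y \<in> pverts (H_star k W v w)" "x \<noteq> y"
    and "(x, y) \<notin> H_star_nonedges k v w"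
  shows "(x, y) \<in> parcs (H_star k W v w)"
proof -
  from assms obtain i j where ij: "i \<in> {1..k}" "j \<in> {1..k}"
    "x \<in> pverts (H_part k W v w i)" "y \<in> pverts (H_part k W v w j)"
    by (auto simp: pverts_H_star)
  show ?thesis
  proof (cases "i = j")
    case False
    with ij show ?thesis by (auto simp: parcs_H_star)
  next
    case True
    \<comment> \<open>Two distinct vertices do not fit into the one-vertex part
      \<open>k\<close>.\<close>
    with ij assms(3) have "i < k"
      by (auto simp: H_part_def single_vertex_graph_def split: if_splits)
    with ij(1) have "(v i, w i) \<in> H_star_nonedges k v w" "(w i, v i) \<in> H_star_nonedges k v w"
      by (auto simp: H_star_nonedges_def)
    with \<open>i < k\<close> True ij assms(3,4) have "(x, y) \<in> parcs (H_part k W v w i)"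
      by (auto simp: H_part_def clique_plus_vertex_def)
    with ij(1) show ?thesis by (auto simp: parcs_H_star)
  qed
qed

section \<open>The chromatic number of \<open>H_star\<close> before and after deleting a
  vertex\<close>

theorem theorem13:
  fixes m k :: nat
    and W :: "nat \<Rightarrow> 'a set" and v w :: "nat \<Rightarrow> 'a"
    and G :: "'b pair_pre_digraph"
  assumes "m \<ge> 3" and "even m"
    and "k \<ge> 1" and "k \<le> m - 1"
    and "disjoint_family_on W {1..k - 1}"
    and "\<And>i. i \<in> {1..k - 1} \<Longrightarrow> finite (W i) \<and> card (W i) = m - 2"
    and "inj_on v {1..k}"
    and "\<And>i j. i \<in> {1..k} \<Longrightarrow> j \<in> {1..k - 1} \<Longrightarrow> v i \<notin> W j"
    and "\<And>i. i \<in> {1..k - 1} \<Longrightarrow> w i \<in> W i"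
    and "G \<in> connected_sub_cocktail_party m"
  shows "k_free_vertex_minimal k (with_proj G) (with_proj (H_star k W v w))"
proof -
  let ?H = "H_star k W v w"
  note card_H = card_pverts_H_star[OF assms(1,3,5-8), of w]
  have card_G: "card (pverts G) = m"
    using assms(10) by (simp add: connected_sub_cocktail_party_def)
  have "(k - 1) * (m - 1) + 1 \<le> (k - 1) * (m - 1) + (m - 1)" using \<open>m \<ge> 3\<close> by simp
  also have "\<dots> = k * (m - 1)" using \<open>k \<ge> 1\<close> by (simp add: mult_eq_if)
  finally have "\<exists>\<pi>. free_colouring (with_proj G) (with_proj ?H) k \<pi>"
    using card_H card_G \<open>m \<ge> 3\<close> by (intro ex_free_colouring) auto
  then obtain \<pi>0 where \<pi>0: "free_colouring (with_proj G) (with_proj ?H) k \<pi>0" by blast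
  then have "free_chromatic_number (with_proj G) (with_proj ?H) \<le> k"
    by (rule free_chromatic_number_le)
  \<comment> \<open>An optimal colouring with at most \<open>k - 1\<close> colours would cover at
    most \<open>(k - 1) * (m - 1)\<close> vertices, one fewer than \<open>H_star\<close>
    has.\<close>
  moreover have "k \<le> free_chromatic_number (with_proj G) (with_proj ?H)"
  proof (rule ccontr)
    let ?j = "free_chromatic_number (with_proj G) (with_proj ?H)"
    assume "\<not> k \<le> ?j"
    then have j: "?j \<le> k - 1" by simp
    obtain \<pi> where \<pi>: "free_colouring (with_proj G) (with_proj ?H) ?j \<pi>"
      using \<pi>0 by (rule free_chromatic_number_attained)
    have "contains_copy (with_proj G) (with_proj ?H \<restriction> A)"
      if "A \<subseteq> verts (with_proj ?H)" "m \<le> card A" for A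
    proof (rule contains_copy_induced_matching_complement[OF assms(10) pair_wf_digraph_H_star
          sym_H_star_nonedges single_valued_H_star_nonedges[OF assms(5,7-9)]])
      show "finite A" "m \<le> card A" "A \<subseteq> pverts ?H"
        using that card_H(1) by (auto intro: finite_subset)
    next
      fix x y assume "x \<in> A" "y \<in> A" "x \<noteq> y" "(x, y) \<notin> H_star_nonedges k v w"
      with that(1) show "(x, y) \<in> parcs ?H" by (intro H_star_adjacent) auto
    qed auto
    then have "card (verts (with_proj ?H)) \<le> ?j * (m - 1)"
      by (rule card_le_free_colouring[OF \<pi>])
    also have "\<dots> \<le> (k - 1) * (m - 1)" using j by (rule mult_le_mono1)
    finally show False using card_H(2) by simp
  qed
  ultimately have eq: "free_chromatic_number (with_proj G) (with_proj ?H) = k" by simp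
  have "free_chromatic_number (with_proj G) (pre_digraph.del_vert (with_proj ?H) x) \<le> k - 1"
    if "x \<in> pverts ?H" for x
  proof -
    \<comment> \<open>Exactly \<open>(k - 1) * (m - 1)\<close> vertices remain, so
      \<open>k - 1\<close> blocks of length \<open>m - 1\<close> suffice. For \<open>k = 1\<close>
      the graph is empty and 0 colours are enough.\<close>
    have "\<exists>\<pi>. free_colouring (with_proj G) (pre_digraph.del_vert (with_proj ?H) x) (k - 1) \<pi>"
      using that card_H card_G \<open>m \<ge> 3\<close>
      by (intro ex_free_colouring) (auto simp: pre_digraph.verts_del_vert)
    then show ?thesis using free_chromatic_number_le by blast
  qed
  \<comment> \<open>Since \<open>k\<close> is positive, the truncated difference
    \<open>k - 1\<close> agrees with the integer one.\<close>
  then have "int (free_chromatic_number (with_proj G) (pre_digraph.del_vert (with_proj ?H) x))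
      \<le> int k - 1" if "x \<in> pverts ?H" for x
    using that \<open>k \<ge> 1\<close> by fastforce
  then show ?thesis
    using eq unfolding k_free_vertex_minimal_def free_vertex_minimal_def by simp
qed

end
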